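(* Let $n\ge 1$, let $0\le \epsilon\le \tfrac12$, and let $f:\{0,1\}^n\to\mathbb{R}$ be a nonnegative function that is not identically zero. (i) For every integer $q\ge 2$, \[ \ln \|T_{\epsilon} f\|_q ~\le~ \mathbb{E}_{T \sim \lambda}\, \ln \| \mathbb{E}(f|T)\|_q , \qquad\text{where } \lambda=\lambda(q,\epsilon) = 1 + \frac{1}{q-1}\log_2\!\big(\epsilon^q + (1-\epsilon)^q\big). \] (ii) Also \[ \ln \|T_{\epsilon} f\|_{\infty} ~\le~ \mathbb{E}_{T \sim \lambda}\, \ln \| \mathbb{E}(f|T)\|_{\infty}, \qquad\text{where } \lambda=\lambda(\infty,\epsilon) = 1 + \log_2(1-\epsilon). \] (iii) Both inequalities hold with equality whenever $f$ is the characteristic function of a (nonempty) subcube of $\{0,1\}^n$.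
   Context: Norms are with respect to the uniform probability measure on $\{0,1\}^n$: $\|g\|_q=(\mathbb{E}_x |g(x)|^q)^{1/q}$ and $\|g\|_\infty=\max_x|g(x)|$. For $0\le\epsilon\le\tfrac12$, the noise operator is $(T_\epsilon f)(x)=\sum_{y\in\{0,1\}^n}\epsilon^{|y-x|}(1-\epsilon)^{n-|y-x|}f(y)$, where $|y-x|$ is the Hamming distance; equivalently $(T_\epsilon f)(x)=\mathbb{E} f(y)$ where each coordinate $y_i$ equals $x_i$ with probability $1-\epsilon$ and $1-x_i$ with probability $\epsilon$, independently. For $0\le\lambda\le1$, $T\sim\lambda$ denotes a random subset $T\subseteq[n]$ containing each element independently with probability $\lambda$. For $T\subseteq[n]$, the conditional expectation $\mathbb{E}(f|T)$ is the function on $\{0,1\}^n$ given by $\mathbb{E}(f|T)(x)=\mathbb{E}_{y:\,y|_T=x|_T} f(y)$ (uniform average over $y$ agreeing with $x$ on the coordinates in $T$). A subcube is a set of the form $\{x\in\{0,1\}^n: x_i=a_i \text{ for all } i\in K\}$ for some $K\subseteq[n]$ and $a\in\{0,1\}^K$. *)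

theory Defs
  imports Complex_Main
begin

definition cube :: "nat \<Rightarrow> bool list set" where
  "cube n = {xs. length xs = n}"

definition cexp :: "nat \<Rightarrow> (bool list \<Rightarrow> real) \<Rightarrow> real" where
  "cexp n g = (\<Sum>x\<in>cube n. g x) / 2 ^ n"

definition qnorm :: "nat \<Rightarrow> nat \<Rightarrow> (bool list \<Rightarrow> real) \<Rightarrow> real" where
  "qnorm n q g = (cexp n (\<lambda>x. \<bar>g x\<bar> ^ q)) powr (1 / real q)"

definition supnorm :: "nat \<Rightarrow> (bool list \<Rightarrow> real) \<Rightarrow> real" where
  "supnorm n g = Max ((\<lambda>x. \<bar>g x\<bar>) ` cube n)"

definition hdist :: "bool list \<Rightarrow> bool list \<Rightarrow> nat" where
  "hdist x y = card {i. i < length x \<and> x ! i \<noteq> y ! i}"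

definition noise :: "nat \<Rightarrow> real \<Rightarrow> (bool list \<Rightarrow> real) \<Rightarrow> bool list \<Rightarrow> real" where
  "noise n \<epsilon> f x = (\<Sum>y\<in>cube n. \<epsilon> ^ hdist y x * (1 - \<epsilon>) ^ (n - hdist y x) * f y)"

definition condexp :: "nat \<Rightarrow> nat set \<Rightarrow> (bool list \<Rightarrow> real) \<Rightarrow> bool list \<Rightarrow> real" where
  "condexp n T f x =
     (let S = {y\<in>cube n. \<forall>i\<in>T. y ! i = x ! i} in (\<Sum>y\<in>S. f y) / real (card S))"

text \<open>Expectation over a random subset T of [n] = {0..<n} containing each element
  independently with probability lam.\<close>
definition rsubset_exp :: "nat \<Rightarrow> real \<Rightarrow> (nat set \<Rightarrow> real) \<Rightarrow> real" where
  "rsubset_exp n lam h =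
     (\<Sum>T\<in>Pow {..<n}. lam ^ card T * (1 - lam) ^ (n - card T) * h T)"

definition lam_q :: "nat \<Rightarrow> real \<Rightarrow> real" where
  "lam_q q \<epsilon> = 1 + (1 / (real q - 1)) * log 2 (\<epsilon> ^ q + (1 - \<epsilon>) ^ q)"

definition lam_inf :: "real \<Rightarrow> real" where
  "lam_inf \<epsilon> = 1 + log 2 (1 - \<epsilon>)"

end

theory Submission
  imports Defs "HOL-Analysis.Convex"
begin

text \<open>
  Changing the noise in a single coordinate gives two points \<open>a, b \<ge> 0\<close> and a two-point inequality
  between the noisy pair, the pair itself and its mean. By homogeneity one takes
  \<open>a = 1 + x\<close>, \<open>b = 1 - x\<close>; with \<open>L x = ln (((1 + x)^q + (1 - x)^q) / 2)\<close> and \<open>r = 1 - 2\<epsilon>\<close> the claim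
  becomes \<open>L (r x) * L 1 \<le> L r * L x\<close>, which follows from the monotonicity of \<open>L' (r x) / L' x\<close>
  (for the supremum norm, \<open>L x = ln (1 + x)\<close>). Hoelder's inequality extends the two-point inequality
  to the cube as \<open>H(\<epsilon>) \<le> \<lambda> H(0) + (1 - \<lambda>) H(1/2)\<close>, where \<open>H\<close> is the logarithm of the norm as a function
  of the noise in that coordinate. Noise \<open>0\<close> keeps a coordinate and noise \<open>1/2\<close> averages over it, so
  iterating over all coordinates produces the expectation over the random set \<open>T\<close>. For a subcube
  \<open>H\<close> is a sum of one-coordinate terms, each of which satisfies the relation with equality.
\<close>

section \<open>Submultiplicativity on the unit interval from a monotone ratio of derivatives\<close>

text \<open>For \<open>G t = L r * L t - L 1 * L (r * t)\<close> the quotient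
  \<open>G' t / L' t\<close> is \<open>L r - r * L 1 * (L' (r * t) / L' t)\<close>, which
  \<open>ratio\<close> makes antitone. So \<open>G\<close> can only rise and then fall between its
  zeros at \<open>0\<close> and \<open>1\<close>.\<close>

lemma submultiplicative_of_deriv_ratio:
  fixes L L' :: "real \<Rightarrow> real"
  assumes cont: "continuous_on {0..1} L"
    and deriv: "\<And>x. 0 < x \<Longrightarrow> x < 1 \<Longrightarrow> (L has_real_derivative L' x) (at x)"
    and pos: "\<And>x. 0 < x \<Longrightarrow> x < 1 \<Longrightarrow> 0 < L' x"
    and L0: "L 0 = 0" and L1: "0 \<le> L 1"
    and ratio: "\<And>c d. 0 < c \<Longrightarrow> c < d \<Longrightarrow> d < 1 \<Longrightarrow> L' (r * c) * L' d \<le> L' (r * d) * L' c"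
    and r: "0 \<le> r" "r \<le> 1" and x: "0 \<le> x" "x \<le> 1"
  shows "L (r * x) * L 1 \<le> L r * L x"
proof (cases "r = 0 \<or> r = 1 \<or> x = 0 \<or> x = 1")
  case True
  then show ?thesis using L0 by auto
next
  case False
  with r x have r': "0 < r" "r < 1" and x': "0 < x" "x < 1" by auto
  define G where "G = (\<lambda>t. L r * L t - L 1 * L (r * t))"
  define G' where "G' = (\<lambda>t. L r * L' t - L 1 * (r * L' (r * t)))"
  have rt: "0 < r * t" "r * t < 1" if "0 < t" "t < 1" for t
    using r' that mult_strict_mono[of r 1 t 1] by auto
  have der: "(G has_real_derivative G' t) (at t)" if t: "0 < t" "t < 1" for t
  proof -
    have "((\<lambda>t. L (r * t)) has_real_derivative L' (r * t) * r) (at t)"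
      by (rule DERIV_chain2[where f = L and g = "\<lambda>t. r * t", OF deriv[OF rt[OF t]]]) (auto intro!: derivative_eq_intros)
    then show ?thesis
      unfolding G_def G'_def using deriv[OF t]
      by (auto intro!: derivative_eq_intros simp: algebra_simps)
  qed
  have "continuous_on {0..1} (\<lambda>t. L (r * t))"
    by (rule continuous_on_compose2[OF cont])
       (use r in \<open>auto intro!: continuous_intros mult_le_one\<close>)
  then have contG: "continuous_on {0..1} G"
    unfolding G_def by (intro continuous_intros cont)
  have difG: "G differentiable (at t)" if "0 < t" "t < 1" for t
    unfolding real_differentiable_def using der[OF that] by blast
  \<comment> \<open>If \<open>G x < 0\<close>, then \<open>G'\<close> is negative at some \<open>c < x\<close> and positive at some \<open>d > x\<close>, but the ratio
    condition only permits sign changes from plus to minus.\<close>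
  have "0 \<le> G x"
  proof (rule ccontr)
    assume neg: "\<not> 0 \<le> G x"
    have mvt: "\<exists>z. a < z \<and> z < b \<and> G b - G a = (b - a) * G' z"
      if ab: "0 \<le> a" "a < b" "b \<le> 1" for a b
    proof -
      have "\<exists>l z. a < z \<and> z < b \<and> DERIV G z :> l \<and> G b - G a = (b - a) * l"
        by (rule MVT[OF ab(2)])
           (use ab in \<open>auto intro!: continuous_on_subset[OF contG] difG\<close>)
      then obtain l z where z: "a < z" "z < b" "DERIV G z :> l" "G b - G a = (b - a) * l" by auto
      have "l = G' z" using z ab by (intro DERIV_unique[OF z(3) der]) auto
      then show ?thesis using z by auto
    qed
    obtain c where c: "0 < c" "c < x" "G x - G 0 = (x - 0) * G' c" using mvt[of 0 x] x' by auto
    obtain d where d: "x < d" "d < 1" "G 1 - G x = (1 - x) * G' d" using mvt[of x 1] x' by auto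
    have "G 0 = 0" "G 1 = 0" by (auto simp: G_def L0)
    with c d neg x' have "x * G' c < 0" "0 < (1 - x) * G' d" by auto
    then have G'c: "G' c < 0" and G'd: "0 < G' d"
      using x' by (auto simp: mult_less_0_iff zero_less_mult_iff)
    have "0 < L' c" "0 < L' d" using c d x' by (auto intro!: pos)
    then have "G' c * L' d < G' d * L' c"
      using G'c G'd by (smt (verit) mult_neg_pos mult_pos_pos)
    \<comment> \<open>The terms \<open>L r * L' c * L' d\<close> on the two sides cancel.\<close>
    then have "L 1 * r * (L' (r * d) * L' c) < L 1 * r * (L' (r * c) * L' d)"
      unfolding G'_def by (simp add: algebra_simps)
    moreover have "L 1 * r * (L' (r * c) * L' d) \<le> L 1 * r * (L' (r * d) * L' c)"
      using ratio[of c d] c d L1 r by (intro mult_left_mono) auto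
    ultimately show False by simp
  qed
  then show ?thesis by (simp add: G_def algebra_simps)
qed

text \<open>The derivative ratio is \<open>(1 + t) / (1 + r * t)\<close>, nondecreasing in
  \<open>t\<close> because \<open>r \<le> 1\<close>: after cross-multiplication the difference is
  \<open>(1 - r) * (d - c)\<close>.\<close>

lemma ln_one_plus_submultiplicative:
  assumes "0 \<le> r" "r \<le> 1" "0 \<le> x" "x \<le> (1::real)"
  shows "ln (1 + r * x) * ln 2 \<le> ln (1 + r) * ln (1 + x)"
proof -
  have "(\<lambda>t. ln (1 + t)) (r * x) * (\<lambda>t. ln (1 + t)) 1 \<le> (\<lambda>t. ln (1 + t)) r * (\<lambda>t::real. ln (1 + t)) x"
  proof (rule submultiplicative_of_deriv_ratio[where L' = "\<lambda>t. 1 / (1 + t)"])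
    show "continuous_on {0..1} (\<lambda>t::real. ln (1 + t))"
      by (intro continuous_intros) auto
    show "((\<lambda>t. ln (1 + t)) has_real_derivative 1 / (1 + t)) (at t)" if "0 < t" for t :: real
      using that by (auto intro!: derivative_eq_intros)
    fix c d :: real assume cd: "0 < c" "c < d" "d < 1"
    have "(1 + r * d) * (1 + c) \<le> (1 + r * c) * (1 + d)"
      using mult_right_mono[of r 1 "d - c"] assms cd by (simp add: algebra_simps)
    moreover have "0 < 1 + r * c" "0 < 1 + r * d"
      using assms cd by (auto intro!: add_pos_nonneg)
    ultimately show "1 / (1 + r * c) * (1 / (1 + d)) \<le> 1 / (1 + r * d) * (1 / (1 + c))"
      using cd by (simp add: divide_simps mult_ac)
  qed (use assms in auto)
  then show ?thesis by (simp add: one_add_one)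
qed

section \<open>Twice the even and twice the odd part of \<open>(1 + x) ^ m\<close>\<close>

definition pow_sum :: "nat \<Rightarrow> real \<Rightarrow> real" where
  "pow_sum m x = (1 + x) ^ m + (1 - x) ^ m"

definition pow_diff :: "nat \<Rightarrow> real \<Rightarrow> real" where
  "pow_diff m x = (1 + x) ^ m - (1 - x) ^ m"

lemma pow_sum_0 [simp]: "pow_sum m 0 = 2"
  by (simp add: pow_sum_def)

lemma pow_sum_1: "0 < m \<Longrightarrow> pow_sum m 1 = 2 ^ m"
  by (simp add: pow_sum_def)

lemma pow_sum_diff_Suc:
  "pow_sum (Suc m) x = pow_sum m x + x * pow_diff m x"
  "pow_diff (Suc m) x = pow_diff m x + x * pow_sum m x"
  by (simp_all add: pow_sum_def pow_diff_def algebra_simps)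

text \<open>Dividing the odd part by \<open>x\<close> makes the recursion positive:
  \<open>pow_sum\<close> gains \<open>x\<^sup>2\<close> times the quotient, and the quotient gains
  \<open>pow_sum\<close>. The two monotonicity claims and the two lower bounds feed each other,
  hence one joint induction.\<close>

lemma pow_sum_diff_quotient_mono:
  assumes "0 < x" "x \<le> y"
  shows "pow_sum m x \<le> pow_sum m y \<and> 2 \<le> pow_sum m x \<and>
         pow_diff m x / x \<le> pow_diff m y / y \<and> 0 \<le> pow_diff m x / x"
proof (induction m)
  case 0
  then show ?case by (simp add: pow_sum_def pow_diff_def)
next
  case (Suc m)
  have sq: "t * pow_diff m t = t\<^sup>2 * (pow_diff m t / t)" if "t > 0" for t
    using that by (simp add: power2_eq_square)
  have "x\<^sup>2 * (pow_diff m x / x) \<le> y\<^sup>2 * (pow_diff m y / y)"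
    using Suc assms by (intro mult_mono power_mono) auto
  moreover have "0 \<le> x\<^sup>2 * (pow_diff m x / x)"
    using Suc by (intro mult_nonneg_nonneg) auto
  moreover have "pow_diff (Suc m) t / t = pow_diff m t / t + pow_sum m t" if "t > 0" for t
    using that by (simp add: pow_sum_diff_Suc add_divide_distrib)
  ultimately show ?case
    using Suc assms sq[of x] sq[of y] by (auto simp: pow_sum_diff_Suc)
qed

lemma pow_sum_mono: "0 \<le> x \<Longrightarrow> x \<le> y \<Longrightarrow> pow_sum m x \<le> pow_sum m y"
  using pow_sum_diff_quotient_mono[of x y m] pow_sum_diff_quotient_mono[of y y m]
  by (cases "x = 0"; cases "y = 0") auto

lemma pow_sum_ge_2: "0 \<le> x \<Longrightarrow> 2 \<le> pow_sum m x"
  using pow_sum_mono[of 0 x m] by simp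

lemma pow_diff_pos: "0 < m \<Longrightarrow> 0 < x \<Longrightarrow> x \<le> 1 \<Longrightarrow> 0 < pow_diff m x"
  unfolding pow_diff_def by (simp add: power_strict_mono)

lemma pow_diff_over_pow_sum_mono:
  assumes "0 < x" "x \<le> y" "y < 1"
  shows "x * pow_diff m x / pow_sum (Suc m) x \<le> y * pow_diff m y / pow_sum (Suc m) y"
proof -
  \<comment> \<open>Divide by powers of \<open>1 + t\<close>: in \<open>s\<close> all factors are visibly monotone.\<close>
  define s where "s t = (1 - t) / (1 + t)" for t :: real
  have eq: "t * pow_diff m t / pow_sum (Suc m) t = (1 - s t) * (1 - s t ^ m) / (2 * (1 + s t ^ Suc m))"
    if t: "0 < t" "t < 1" for t
  proof -
    let ?a = "1 + t" and ?b = "1 - t"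
    have b: "?b = ?a * s t" using t by (simp add: s_def)
    then have "t = ?a * (1 - s t) / 2" by (simp add: algebra_simps)
    moreover have bk: "?b ^ k = ?a ^ k * s t ^ k" for k
      unfolding b power_mult_distrib ..
    have "pow_diff m t = ?a ^ m * (1 - s t ^ m)"
      unfolding pow_diff_def bk right_diff_distrib by simp
    moreover have "pow_sum (Suc m) t = ?a ^ Suc m * (1 + s t ^ Suc m)"
      unfolding pow_sum_def bk distrib_left by simp
    ultimately have "t * pow_diff m t / pow_sum (Suc m) t
        = (?a * (1 - s t) / 2) * (?a ^ m * (1 - s t ^ m)) / (?a ^ Suc m * (1 + s t ^ Suc m))"
      by metis
    also have "\<dots> = (?a ^ Suc m * ((1 - s t) * (1 - s t ^ m))) / (?a ^ Suc m * (2 * (1 + s t ^ Suc m)))"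
      by (simp add: field_simps)
    finally show ?thesis using t by simp
  qed
  have s: "0 \<le> s y" "s y \<le> s x" "s x \<le> 1"
    using assms by (auto simp: s_def field_simps)
  have "(1 - s x) * (1 - s x ^ m) / (2 * (1 + s x ^ Suc m)) \<le> (1 - s y) * (1 - s y ^ m) / (2 * (1 + s y ^ Suc m))"
    using s by (intro frac_le mult_mono mult_nonneg_nonneg add_mono diff_mono power_mono mult_left_mono)
      (auto intro!: power_le_one add_pos_nonneg)
  then show ?thesis using assms by (simp add: eq)
qed

text \<open>The left-hand side is the derivative of \<open>ln (pow_diff (m + 1) x / pow_sum (m + 2) x)\<close>. Multiplied by
  \<open>x\<close>, both terms on the right are antitone in \<open>x\<close>, which is not the case on the left.\<close>

lemma log_deriv_identity:
  assumes "0 < x" "x < 1"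
  shows "real (Suc m) * pow_sum m x / pow_diff (Suc m) x - real (m + 2) * pow_diff (Suc m) x / pow_sum (m + 2) x
     = 4 * real (Suc m) * (1 - x\<^sup>2) ^ m / (pow_diff (Suc m) x * pow_sum (m + 2) x)
       - pow_diff (Suc m) x / pow_sum (m + 2) x"
proof -
  \<comment> \<open>With \<open>u = 1 + x\<close> and \<open>v = 1 - x\<close> the left-hand side is
    \<open>(u * v) ^ m * (u + v)\<^sup>2\<close>, and \<open>u + v = 2\<close>.\<close>
  have key: "pow_sum m x * pow_sum (m + 2) x - pow_diff (Suc m) x ^ 2 = 4 * (1 - x\<^sup>2) ^ m"
  proof -
    have "1 - x\<^sup>2 = (1 + x) * (1 - x)" by (simp add: algebra_simps power2_eq_square)
    then have "(1 - x\<^sup>2) ^ m = (1 + x) ^ m * (1 - x) ^ m" by (simp add: power_mult_distrib)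
    then show ?thesis
      by (simp add: pow_sum_def pow_diff_def power2_eq_square algebra_simps)
  qed
  have P: "0 < pow_diff (Suc m) x" "0 < pow_sum (m + 2) x"
    using assms pow_diff_pos[of "Suc m" x] pow_sum_ge_2[of x "m + 2"] by auto
  define A B C where "A = pow_sum m x" and "B = pow_diff (Suc m) x" and "C = pow_sum (m + 2) x"
  have "4 * real (Suc m) * (1 - x\<^sup>2) ^ m = real (Suc m) * (4 * (1 - x\<^sup>2) ^ m)" by simp
  also have "4 * (1 - x\<^sup>2) ^ m = A * C - B ^ 2" using key by (simp add: A_def B_def C_def)
  finally have eq: "4 * real (Suc m) * (1 - x\<^sup>2) ^ m = real (Suc m) * (A * C - B ^ 2)" .
  show ?thesis
    using P unfolding eq A_def[symmetric] B_def[symmetric] C_def[symmetric]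
    by (simp add: field_simps power2_eq_square)
qed

text \<open>If \<open>w'\<close> is the bracketed logarithmic derivative, antitonicity of
  \<open>t * w' t\<close> says \<open>t * w' t \<le> (r * t) * w' (r * t)\<close>, so
  \<open>w (r * t) - w t\<close> has nonnegative derivative. The factor \<open>t\<close> is absorbed
  into the denominator as \<open>pow_diff (Suc m) t / t\<close>, which is monotone.\<close>

lemma scaled_log_deriv_antimono:
  assumes "0 < x" "x \<le> y" "y < 1"
  shows "y * (real (Suc m) * pow_sum m y / pow_diff (Suc m) y - real (m + 2) * pow_diff (Suc m) y / pow_sum (m + 2) y)
      \<le> x * (real (Suc m) * pow_sum m x / pow_diff (Suc m) x - real (m + 2) * pow_diff (Suc m) x / pow_sum (m + 2) x)"
proof -
  have e: "t * (real (Suc m) * pow_sum m t / pow_diff (Suc m) t - real (m + 2) * pow_diff (Suc m) t / pow_sum (m + 2) t)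
     = 4 * real (Suc m) * (1 - t\<^sup>2) ^ m / (pow_diff (Suc m) t / t * pow_sum (m + 2) t)
       - t * pow_diff (Suc m) t / pow_sum (m + 2) t" if "0 < t" "t < 1" for t
    using that by (subst log_deriv_identity) (simp_all add: right_diff_distrib)
  have q: "0 < pow_diff (Suc m) x / x" using assms pow_diff_pos[of "Suc m" x] by simp
  have y2: "y\<^sup>2 \<le> 1" using assms by (simp add: power_le_one)
  have x2: "x\<^sup>2 \<le> y\<^sup>2" using assms by (intro power_mono) auto
  have "4 * real (Suc m) * (1 - y\<^sup>2) ^ m / (pow_diff (Suc m) y / y * pow_sum (m + 2) y)
      \<le> 4 * real (Suc m) * (1 - x\<^sup>2) ^ m / (pow_diff (Suc m) x / x * pow_sum (m + 2) x)"
  proof (rule frac_le)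
    show "4 * real (Suc m) * (1 - y\<^sup>2) ^ m \<le> 4 * real (Suc m) * (1 - x\<^sup>2) ^ m"
      using x2 y2 by (intro mult_left_mono power_mono) auto
    show "pow_diff (Suc m) x / x * pow_sum (m + 2) x \<le> pow_diff (Suc m) y / y * pow_sum (m + 2) y"
      using assms pow_sum_diff_quotient_mono[of x y "Suc m"] pow_sum_diff_quotient_mono[of y y "Suc m"]
        pow_sum_ge_2[of x "m + 2"] pow_sum_mono[of x y "m + 2"]
      by (intro mult_mono) linarith+
    show "0 < pow_diff (Suc m) x / x * pow_sum (m + 2) x"
      using assms q pow_sum_ge_2[of x "m + 2"] by (intro mult_pos_pos) linarith+
  qed (use x2 y2 in simp)
  moreover have "x * pow_diff (Suc m) x / pow_sum (m + 2) x \<le> y * pow_diff (Suc m) y / pow_sum (m + 2) y"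
    using pow_diff_over_pow_sum_mono[OF assms, of "Suc m"] by simp
  ultimately show ?thesis using assms by (simp only: e)
qed

lemma DERIV_pow_sum: "(pow_sum (Suc m) has_real_derivative real (Suc m) * pow_diff m x) (at x)"
  unfolding pow_sum_def[abs_def] pow_diff_def
  by (rule derivative_eq_intros refl)+ (simp add: right_diff_distrib)

lemma DERIV_pow_diff: "(pow_diff (Suc m) has_real_derivative real (Suc m) * pow_sum m x) (at x)"
  unfolding pow_diff_def[abs_def] pow_sum_def
  by (rule derivative_eq_intros refl)+ (simp add: distrib_left)

text \<open>Here \<open>L' t = q * exp (w t)\<close> inside the interval, so the ratio condition on
  \<open>L'\<close> is exactly that \<open>w (r * t) - w t\<close> is nondecreasing.\<close>

lemma ln_pow_sum_submultiplicative:
  assumes r: "0 \<le> r" "r \<le> 1" and x: "0 \<le> x" "x \<le> (1::real)" and q: "2 \<le> (q::nat)"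
  shows "ln (pow_sum q (r * x) / 2) * ln (2 ^ (q - 1)) \<le> ln (pow_sum q r / 2) * ln (pow_sum q x / 2)"
proof -
  obtain m where m: "q = m + 2" using q by (metis add.commute le_Suc_ex)
  define L where "L = (\<lambda>t. ln (pow_sum q t / 2))"
  define L' where "L' = (\<lambda>t. real q * pow_diff (Suc m) t / pow_sum q t)"
  define w where "w = (\<lambda>t. ln (pow_diff (Suc m) t) - ln (pow_sum q t))"
  define w' where "w' = (\<lambda>t. real (Suc m) * pow_sum m t / pow_diff (Suc m) t - real (m + 2) * pow_diff (Suc m) t / pow_sum (m + 2) t)"
  have S: "0 < pow_sum q t" if "0 \<le> t" for t using pow_sum_ge_2[OF that, of q] by simp
  have D: "0 < pow_diff (Suc m) t" if "0 < t" "t < 1" for t using that pow_diff_pos[of "Suc m" t] by simp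
  have dS: "(pow_sum q has_real_derivative real q * pow_diff (Suc m) t) (at t)" for t
    using DERIV_pow_sum[of "Suc m" t] by (simp add: m)
  have dD: "(pow_diff (Suc m) has_real_derivative real (Suc m) * pow_sum m t) (at t)" for t
    by (rule DERIV_pow_diff)
  have dw: "(w has_real_derivative w' t) (at t)" if "0 < t" "t < 1" for t
    unfolding w_def w'_def m[symmetric] using S[of t] D[of t] that
    by (auto intro!: derivative_eq_intros dS dD)
  have mono: "w (r * c) - w c \<le> w (r * d) - w d" if r0: "0 < r" and cd: "0 < c" "c < d" "d < 1" for c d
  proof (rule DERIV_nonneg_imp_nondecreasing[where f = "\<lambda>t. w (r * t) - w t"])
    fix t assume t: "c \<le> t" "t \<le> d"
    have t01: "0 < t" "t < 1" using t cd by auto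
    have rt_le: "0 < r * t" "r * t \<le> t"
      using t01 r r0 by (auto intro: mult_left_le_one_le)
    then have rt: "0 < r * t" "r * t \<le> t" "r * t < 1"
      using t01 by linarith+
    have "((\<lambda>t. w (r * t)) has_real_derivative w' (r * t) * r) (at t)"
      by (rule DERIV_chain2[where f = w and g = "\<lambda>t. r * t", OF dw[OF rt(1,3)]]) (auto intro!: derivative_eq_intros)
    then have "((\<lambda>t. w (r * t) - w t) has_real_derivative w' (r * t) * r - w' t) (at t)"
      by (intro DERIV_diff dw t01)
    moreover have "t * w' t \<le> (r * t) * w' (r * t)"
      using scaled_log_deriv_antimono[of "r * t" t m] rt t01 by (simp add: w'_def)
    then have "t * (w' (r * t) * r - w' t) \<ge> 0" by (simp add: algebra_simps)
    then have "w' (r * t) * r - w' t \<ge> 0" using t01 by (simp add: zero_le_mult_iff)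
    ultimately show "\<exists>y. ((\<lambda>t. w (r * t) - w t) has_real_derivative y) (at t) \<and> 0 \<le> y" by blast
  qed (use cd in auto)
  have "L (r * x) * L 1 \<le> L r * L x"
  proof (rule submultiplicative_of_deriv_ratio[where L' = L'])
    show "continuous_on {0..1} L" unfolding L_def
    proof (intro continuous_intros)
      show "continuous_on {0..1} (pow_sum q)"
        unfolding pow_sum_def[abs_def] by (intro continuous_intros)
      show "\<forall>t\<in>{0..1}. pow_sum q t / 2 \<noteq> 0" using S by fastforce
    qed auto
    show "(L has_real_derivative L' t) (at t)" if "0 < t" "t < 1" for t
      unfolding L_def L'_def using S[of t] that
      by (auto intro!: derivative_eq_intros dS)
    show "0 < L' t" if "0 < t" "t < 1" for t
      unfolding L'_def using D[OF that] S[of t] that q by simp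
    show "L 0 = 0" by (simp add: L_def)
    show "0 \<le> L 1" unfolding L_def using pow_sum_ge_2[of 1 q] by simp
    fix c d :: real assume cd: "0 < c" "c < d" "d < 1"
    show "L' (r * c) * L' d \<le> L' (r * d) * L' c"
    \<comment> \<open>For \<open>r = 0\<close> the function \<open>L'\<close> is evaluated at
      \<open>0\<close>, where it vanishes and has no exponential form.\<close>
    proof (cases "r = 0")
      case True
      then show ?thesis by (simp add: L'_def pow_diff_def)
    next
      case False
      then have r0: "0 < r" using r by simp
      have L'w: "L' t = real q * exp (w t)" if "0 < t" "t < 1" for t
        using D[OF that] S[of t] that by (simp add: L'_def w_def exp_diff)
      have "r * c < 1" "r * d < 1"
        using cd r mult_left_le_one_le[of c r] mult_left_le_one_le[of d r] by linarith+
      moreover have "exp (w (r * c) + w d) \<le> exp (w (r * d) + w c)" using mono[OF r0 cd] by simp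
      ultimately show ?thesis using cd r0 by (simp add: L'w exp_add mult.assoc mult.left_commute mult_left_mono)
    qed
  qed (use r x in auto)
  moreover have "pow_sum q 1 / 2 = 2 ^ (q - 1)" using q by (simp add: pow_sum_1 m)
  ultimately show ?thesis by (simp add: L_def)
qed

section \<open>The parameters lambda and the two-point inequalities\<close>

text \<open>With \<open>r = 1 - 2 * e\<close> one has \<open>1 + r = 2 * (1 - e)\<close> and
  \<open>1 - r = 2 * e\<close>. Thus lambda is \<open>L r / L 1\<close> for
  \<open>L x = ln (pow_sum q x / 2)\<close>, the value that makes the two-point inequality tight at
  \<open>x = 1\<close>, where one of the two points is \<open>0\<close>.\<close>

lemma lam_q_eq:
  assumes "0 \<le> e" "e \<le> 1 / 2" "2 \<le> q"
  shows "lam_q q e = ln (pow_sum q (1 - 2 * e) / 2) / ln (2 ^ (q - 1))"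
proof -
  obtain m where m: "q = Suc m" "0 < m" using assms(3) by (cases q) auto
  have "pow_sum q (1 - 2 * e) = (2 * (1 - e)) ^ q + (2 * e) ^ q"
    by (simp add: pow_sum_def algebra_simps)
  also have "\<dots> = 2 ^ q * (e ^ q + (1 - e) ^ q)"
    unfolding power_mult_distrib by (simp add: distrib_left)
  finally have *: "pow_sum q (1 - 2 * e) / 2 = 2 ^ m * (e ^ q + (1 - e) ^ q)"
    by (simp add: m)
  have "0 < e ^ q + (1 - e) ^ q" using assms by (intro add_nonneg_pos) auto
  then have "ln (2 ^ m * (e ^ q + (1 - e) ^ q)) = real m * ln 2 + ln (e ^ q + (1 - e) ^ q)"
    by (simp add: ln_mult ln_realpow)
  then show ?thesis unfolding lam_q_def * using m
    by (simp add: ln_realpow log_def add_divide_distrib)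
qed

lemma lam_q_bounds:
  assumes "0 \<le> e" "e \<le> 1 / 2" "2 \<le> q"
  shows "0 \<le> lam_q q e" "lam_q q e \<le> 1"
proof -
  have "2 \<le> pow_sum q (1 - 2 * e)" using assms by (intro pow_sum_ge_2) auto
  moreover have "pow_sum q (1 - 2 * e) \<le> pow_sum q 1" using assms by (intro pow_sum_mono) auto
  moreover have "pow_sum q 1 / 2 = 2 ^ (q - 1)" using assms(3) by (cases q) (auto simp: pow_sum_1)
  ultimately show "0 \<le> lam_q q e" "lam_q q e \<le> 1"
    unfolding lam_q_eq[OF assms] using assms(3) by (auto simp: divide_le_eq_1)
qed

lemma lam_inf_bounds:
  assumes "0 \<le> e" "e \<le> 1 / 2"
  shows "0 \<le> lam_inf e" "lam_inf e \<le> 1"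
proof -
  have "log 2 (1 / 2) \<le> log 2 (1 - e)" using assms by (intro log_mono) auto
  then show "0 \<le> lam_inf e" unfolding lam_inf_def by (simp add: log_divide)
  show "lam_inf e \<le> 1" unfolding lam_inf_def using assms by simp
qed

text \<open>In the coordinates \<open>a = s * (1 + x)\<close>, \<open>b = s * (1 - x)\<close>, noise
  fixes the mean \<open>s\<close> and contracts \<open>x\<close> to \<open>r * x\<close>. Dividing
  \<open>ln_pow_sum_submultiplicative\<close> by \<open>L 1\<close> and exponentiating bounds the
  contracted pair.\<close>

lemma two_point_power_mean:
  assumes e: "0 \<le> e" "e \<le> 1 / 2" and q: "2 \<le> q" and ab: "0 \<le> a" "0 \<le> (b::real)"
  shows "(((1 - e) * a + e * b) ^ q + ((1 - e) * b + e * a) ^ q) / 2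
     \<le> ((a ^ q + b ^ q) / 2) powr lam_q q e * (((a + b) / 2) ^ q) powr (1 - lam_q q e)"
  using ab
proof (induction b a rule: linorder_wlog)
  case (le b a)
  define s x r where "s = (a + b) / 2" and "x = (a - b) / (a + b)" and "r = 1 - 2 * e"
  show ?case
  proof (cases "s = 0")
    case True
    then have "a = 0" "b = 0" using le s_def by auto
    then show ?thesis using q by (simp add: power_0_left)
  next
    case False
    then have s: "0 < s" using le by (auto simp: s_def)
    have x: "0 \<le> x" "x \<le> 1" using le s by (auto simp: x_def s_def field_simps)
    have r: "0 \<le> r" "r \<le> 1" using e by (auto simp: r_def)
    have "s * x = (a - b) / 2" using s unfolding x_def s_def by (simp add: divide_simps)
    then have a: "a = s * (1 + x)" and b: "b = s * (1 - x)"
      by (auto simp: s_def algebra_simps add_divide_distrib diff_divide_distrib)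
    have 1: "(1 - e) * a + e * b = s * (1 + r * x)" "(1 - e) * b + e * a = s * (1 - r * x)"
      unfolding a b r_def by (auto simp: algebra_simps)
    have S: "1 \<le> pow_sum q t / 2" if "0 \<le> t" for t using pow_sum_ge_2[OF that] by simp
    let ?A = "pow_sum q (r * x) / 2" and ?B = "pow_sum q x / 2" and ?l = "lam_q q e"
    have "0 < ln (2 ^ (q - 1) :: real)" using q by simp
    then have "ln ?A \<le> ?l * ln ?B"
      using ln_pow_sum_submultiplicative[OF r x q] unfolding lam_q_eq[OF e q] r_def
      by (simp add: field_simps)
    also have "\<dots> = ln (?B powr ?l)" using S[OF x(1)] by (simp add: ln_powr)
    finally have AB: "?A \<le> ?B powr ?l" using S[of x] S[of "r * x"] x r by (subst (asm) ln_le_cancel_iff) auto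
    have "(((1 - e) * a + e * b) ^ q + ((1 - e) * b + e * a) ^ q) / 2 = s ^ q * ?A"
      unfolding 1 pow_sum_def power_mult_distrib by (simp add: distrib_left)
    also have "\<dots> \<le> s ^ q * ?B powr ?l" using AB s by (intro mult_left_mono) auto
    \<comment> \<open>The scale \<open>s ^ q\<close> is split into its powers with exponents lambda
      and one minus lambda.\<close>
    also have "\<dots> = (s ^ q * ?B) powr ?l * (s ^ q) powr (1 - ?l)"
      using s S[OF x(1)] powr_mult[of "s ^ q" ?B ?l] by (simp add: powr_diff)
    also have "s ^ q * ?B = (a ^ q + b ^ q) / 2"
      unfolding a b pow_sum_def power_mult_distrib by (simp add: distrib_left)
    finally show ?thesis unfolding s_def .
  qed
qed (simp_all add: add.commute)

text \<open>The same normalisation works with \<open>L x = ln (1 + x)\<close>, for which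
  \<open>lam_inf e = ln (1 + r) / ln 2\<close>. The left-hand side is not symmetric in
  \<open>a\<close> and \<open>b\<close>, so the order of the two points is treated by hand.\<close>

lemma two_point_max:
  assumes e: "0 \<le> e" "e \<le> 1 / 2" and ab: "0 \<le> a" "0 \<le> (b::real)"
  shows "(1 - e) * a + e * b \<le> max a b powr lam_inf e * ((a + b) / 2) powr (1 - lam_inf e)"
proof -
  have main: "(1 - e) * a + e * b \<le> a powr lam_inf e * ((a + b) / 2) powr (1 - lam_inf e)"
    if ab: "0 \<le> b" "b \<le> a" for a b
  proof -
    define s x r where "s = (a + b) / 2" and "x = (a - b) / (a + b)" and "r = 1 - 2 * e"
    show ?thesis
    proof (cases "s = 0")
      case True
      then have "a = 0" "b = 0" using ab s_def by auto
      then show ?thesis by simp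
    next
      case False
      then have s: "0 < s" using ab by (auto simp: s_def)
      have x: "0 \<le> x" "x \<le> 1" using ab s by (auto simp: x_def s_def field_simps)
      have r: "0 \<le> r" "r \<le> 1" using e by (auto simp: r_def)
      have "s * x = (a - b) / 2" using s unfolding x_def s_def by (simp add: divide_simps)
      then have a: "a = s * (1 + x)" and b: "b = s * (1 - x)"
        by (auto simp: s_def algebra_simps add_divide_distrib diff_divide_distrib)
      have rx: "0 \<le> r * x" using r x by simp
      let ?l = "lam_inf e"
      have "ln (1 + r) = ln (2 * (1 - e))" by (rule arg_cong[where f = ln]) (simp add: r_def)
      also have "\<dots> = ln 2 * ?l"
        using e by (subst ln_mult) (auto simp: lam_inf_def log_def field_simps)
      finally have "ln (1 + r) = ln 2 * ?l" .
      then have "ln (1 + r * x) \<le> ?l * ln (1 + x)"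
        using ln_one_plus_submultiplicative[OF r x] by (simp add: mult_ac)
      also have "\<dots> = ln ((1 + x) powr ?l)" using x by (simp add: ln_powr)
      finally have AB: "1 + r * x \<le> (1 + x) powr ?l"
        using x rx by (subst (asm) ln_le_cancel_iff) auto
      have "(1 - e) * a + e * b = s * (1 + r * x)"
        unfolding a b r_def by (simp add: algebra_simps)
      also have "\<dots> \<le> s * (1 + x) powr ?l" using AB s by (intro mult_left_mono) auto
      also have "\<dots> = a powr ?l * s powr (1 - ?l)"
        unfolding a using s x by (simp add: powr_mult powr_diff)
      finally show ?thesis unfolding s_def .
    qed
  qed
  show ?thesis
  proof (cases "b \<le> a")
    case True
    then show ?thesis using main[of b a] ab by (simp add: max_def)
  next
    case False
    \<comment> \<open>Since \<open>e \<le> 1 - e\<close>, putting the larger weight on the larger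
      value only increases the left-hand side, while the right-hand side is symmetric.\<close>
    then have "(1 - 2 * e) * a \<le> (1 - 2 * e) * b" using e by (intro mult_left_mono) auto
    then have "(1 - e) * a + e * b \<le> (1 - e) * b + e * a" by (simp add: algebra_simps)
    also note main[of a b]
    finally show ?thesis using False ab by (simp add: max_def add.commute)
  qed
qed

section \<open>Hoelder's inequality and averages over the cube\<close>

text \<open>Hoelder's inequality with exponents \<open>1 / l\<close> and \<open>1 / (1 - l)\<close>,
  endpoints included: Young's inequality is applied to the normalised terms
  \<open>u x / sum u A\<close> and \<open>v x / sum v A\<close>, and the resulting weights sum to
  one.\<close>

lemma sum_powr_mult_powr_le:
  fixes u v :: "'a \<Rightarrow> real"
  assumes A: "finite A" and nn: "\<And>x. x \<in> A \<Longrightarrow> 0 \<le> u x" "\<And>x. x \<in> A \<Longrightarrow> 0 \<le> v x"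
    and l: "0 \<le> l" "l \<le> 1" and pos: "0 < sum u A" "0 < sum v A"
  shows "(\<Sum>x\<in>A. u x powr l * v x powr (1 - l)) \<le> sum u A powr l * sum v A powr (1 - l)"
proof -
  let ?U = "sum u A" and ?V = "sum v A"
  let ?C = "?U powr l * ?V powr (1 - l)"
  have "u x powr l * v x powr (1 - l) \<le> ?C * (l * (u x / ?U) + (1 - l) * (v x / ?V))"
    if x: "x \<in> A" for x
  proof (cases "u x = 0 \<or> v x = 0")
    \<comment> \<open>The left-hand term is \<open>0\<close> even when the exponent is
      \<open>0\<close>, because \<open>0 powr 0 = 0\<close>.\<close>
    case True
    have "0 \<le> ?C * (l * (u x / ?U) + (1 - l) * (v x / ?V))"
      using nn[OF x] l pos by (intro mult_nonneg_nonneg add_nonneg_nonneg divide_nonneg_nonneg) auto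
    then show ?thesis using True by auto
  next
    case False
    then have uv: "0 < u x" "0 < v x" using nn[OF x] by auto
    have "(u x / ?U) powr l * (v x / ?V) powr (1 - l) \<le> l * (u x / ?U) + (1 - l) * (v x / ?V)"
      using uv pos l by (intro Youngs_inequality_0) auto
    then have "?C * ((u x / ?U) powr l * (v x / ?V) powr (1 - l)) \<le> ?C * (l * (u x / ?U) + (1 - l) * (v x / ?V))"
      by (intro mult_left_mono) auto
    then show ?thesis using uv pos by (simp add: powr_divide)
  qed
  then have "(\<Sum>x\<in>A. u x powr l * v x powr (1 - l)) \<le> (\<Sum>x\<in>A. ?C * (l * (u x / ?U) + (1 - l) * (v x / ?V)))"
    by (rule sum_mono)
  also have "\<dots> = ?C * (l * (?U / ?U) + (1 - l) * (?V / ?V))"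
    by (simp only: sum_distrib_left[symmetric] sum.distrib sum_divide_distrib[symmetric])
  also have "\<dots> = ?C" using pos by simp
  finally show ?thesis .
qed

lemma cube_0: "cube 0 = {[]}"
  by (auto simp: cube_def)

lemma cube_Suc: "cube (Suc n) = (#) True ` cube n \<union> (#) False ` cube n"
  by (auto simp: cube_def length_Suc_conv)

lemma finite_cube [simp]: "finite (cube n)"
  by (induction n) (simp_all add: cube_0 cube_Suc)

lemma cube_nonempty [simp]: "cube n \<noteq> {}"
  by (induction n) (simp_all add: cube_0 cube_Suc)

text \<open>The induction splits off the head of the list; \<open>c\<close> is generalised because
  this shifts the indices of the remaining coordinates.\<close>

lemma sum_cube_prod:
  fixes c :: "nat \<Rightarrow> bool \<Rightarrow> real"
  shows "(\<Sum>y\<in>cube n. \<Prod>i<n. c i (y ! i)) = (\<Prod>i<n. c i True + c i False)"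
proof (induction n arbitrary: c)
  case 0
  then show ?case by (simp add: cube_0)
next
  case (Suc n)
  have "(\<Sum>y\<in>cube (Suc n). \<Prod>i<Suc n. c i (y ! i))
      = (\<Sum>y\<in>cube n. \<Prod>i<Suc n. c i ((True # y) ! i)) + (\<Sum>y\<in>cube n. \<Prod>i<Suc n. c i ((False # y) ! i))"
    unfolding cube_Suc by (subst sum.union_disjoint) (auto simp: sum.reindex inj_on_def)
  also have "\<dots> = (c 0 True + c 0 False) * (\<Sum>y\<in>cube n. \<Prod>i<n. c (Suc i) (y ! i))"
    by (simp add: prod.lessThan_Suc_shift sum_distrib_left distrib_right sum.distrib del: prod.lessThan_Suc)
  also have "\<dots> = (\<Prod>i<Suc n. c i True + c i False)"
    by (simp add: Suc.IH[of "\<lambda>i. c (Suc i)"] prod.lessThan_Suc_shift del: prod.lessThan_Suc)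
  finally show ?case .
qed

definition flip :: "nat \<Rightarrow> bool list \<Rightarrow> bool list" where
  "flip j x = x[j := \<not> x ! j]"

lemma flip_in_cube [simp]: "x \<in> cube n \<Longrightarrow> flip j x \<in> cube n"
  by (simp add: flip_def cube_def)

lemma flip_flip: "j < length x \<Longrightarrow> flip j (flip j x) = x"
  by (simp add: flip_def)

lemma nth_flip: "j < length x \<Longrightarrow> flip j x ! i = (if i = j then \<not> x ! i else x ! i)"
  by (simp add: flip_def)

lemma sum_cube_flip:
  assumes "j < n"
  shows "(\<Sum>x\<in>cube n. h (flip j x)) = (\<Sum>x\<in>cube n. h x)"
  by (rule sum.reindex_bij_witness[where i = "flip j" and j = "flip j"])
     (use assms in \<open>auto simp: flip_flip cube_def flip_def\<close>)

text \<open>Flipping a coordinate permutes the cube. Pairing each point with its flip lets a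
  two-point inequality be applied pointwise under the average.\<close>

lemma cexp_flip_average:
  assumes "j < n"
  shows "cexp n h = cexp n (\<lambda>x. (h x + h (flip j x)) / 2)"
  unfolding cexp_def sum_divide_distrib[symmetric] sum.distrib sum_cube_flip[OF assms] by simp

lemma cexp_powr_mult_powr_le:
  assumes nn: "\<And>x. x \<in> cube n \<Longrightarrow> 0 \<le> u x" "\<And>x. x \<in> cube n \<Longrightarrow> 0 \<le> v x"
    and l: "0 \<le> l" "l \<le> 1" and pos: "0 < cexp n u" "0 < cexp n v"
  shows "cexp n (\<lambda>x. u x powr l * v x powr (1 - l)) \<le> cexp n u powr l * cexp n v powr (1 - l)"
proof -
  have "0 < sum u (cube n)" "0 < sum v (cube n)"
    using pos by (auto simp: cexp_def zero_less_divide_iff)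
  then have "(\<Sum>x\<in>cube n. u x powr l * v x powr (1 - l)) / 2 ^ n
      \<le> sum u (cube n) powr l * sum v (cube n) powr (1 - l) / 2 ^ n"
    using nn l by (intro divide_right_mono sum_powr_mult_powr_le) auto
  \<comment> \<open>The normalisation \<open>2 ^ n\<close> is distributed over the two factors; the
    exponents add up to one.\<close>
  also have "\<dots> = sum u (cube n) powr l * sum v (cube n) powr (1 - l) / ((2 ^ n) powr l * (2 ^ n) powr (1 - l))"
    by (simp flip: powr_add)
  finally show ?thesis unfolding cexp_def
    by (simp add: powr_divide)
qed

lemma cexp_mono:
  "(\<And>x. x \<in> cube n \<Longrightarrow> g x \<le> h x) \<Longrightarrow> cexp n g \<le> cexp n h"
  unfolding cexp_def by (intro divide_right_mono sum_mono) auto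

lemma cexp_cong:
  "(\<And>x. x \<in> cube n \<Longrightarrow> g x = h x) \<Longrightarrow> cexp n g = cexp n h"
  unfolding cexp_def by (metis (no_types, lifting) sum.cong)

lemma cexp_pos:
  assumes "\<And>x. x \<in> cube n \<Longrightarrow> 0 \<le> g x" "x \<in> cube n" "0 < g x"
  shows "0 < cexp n g"
  unfolding cexp_def using assms by (intro divide_pos_pos sum_pos2[where i = x]) auto

lemma qnorm_cong:
  "(\<And>x. x \<in> cube n \<Longrightarrow> g x = h x) \<Longrightarrow> qnorm n q g = qnorm n q h"
  unfolding qnorm_def by (metis (no_types, lifting) cexp_cong)

lemma supnorm_cong:
  "(\<And>x. x \<in> cube n \<Longrightarrow> g x = h x) \<Longrightarrow> supnorm n g = supnorm n h"
  unfolding supnorm_def by (metis (no_types, lifting) image_cong)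

lemma le_supnorm: "x \<in> cube n \<Longrightarrow> g x \<le> supnorm n g"
  unfolding supnorm_def by (rule order_trans[OF abs_ge_self]) (intro Max_ge; simp)

lemma supnorm_attained:
  obtains x where "x \<in> cube n" "supnorm n g = \<bar>g x\<bar>"
proof -
  have "supnorm n g \<in> (\<lambda>x. \<bar>g x\<bar>) ` cube n" unfolding supnorm_def by (intro Max_in) auto
  then show ?thesis using that by auto
qed

section \<open>Noise in a single coordinate\<close>

definition mix :: "nat \<Rightarrow> real \<Rightarrow> (bool list \<Rightarrow> real) \<Rightarrow> bool list \<Rightarrow> real" where
  "mix j e g x = (1 - e) * g x + e * g (flip j x)"

context
  fixes n j :: nat and g :: "bool list \<Rightarrow> real" and z :: "bool list"
  assumes j: "j < n" and g_nonneg: "\<And>x. x \<in> cube n \<Longrightarrow> 0 \<le> g x"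
    and z: "z \<in> cube n" "0 < g z"
begin

lemma mix_nonneg: "0 \<le> t \<Longrightarrow> t \<le> 1 / 2 \<Longrightarrow> x \<in> cube n \<Longrightarrow> 0 \<le> mix j t g x"
  by (simp add: mix_def g_nonneg)

text \<open>The point \<open>z\<close> keeps weight at least one half. This makes every norm below
  positive, so that logarithms may be compared and expanded.\<close>

lemma mix_pos: "0 \<le> t \<Longrightarrow> t \<le> 1 / 2 \<Longrightarrow> 0 < mix j t g z"
  unfolding mix_def by (intro add_pos_nonneg mult_pos_pos mult_nonneg_nonneg g_nonneg) (auto simp: z)

text \<open>The \<open>q\<close>-th moment is averaged over pairs \<open>x\<close>,
  \<open>flip j x\<close>; the two-point inequality bounds each pair, and Hoelder's inequality pulls
  the powers out of the average. Taking logarithms and dividing by \<open>q\<close> gives the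
  norms.\<close>

lemma ln_qnorm_mix_le:
  assumes e: "0 \<le> e" "e \<le> 1 / 2" and q: "2 \<le> q"
  shows "ln (qnorm n q (mix j e g)) \<le> lam_q q e * ln (qnorm n q (mix j 0 g))
     + (1 - lam_q q e) * ln (qnorm n q (mix j (1 / 2) g))"
proof -
  let ?l = "lam_q q e"
  let ?N = "\<lambda>t x. \<bar>mix j t g x\<bar> ^ q"
  let ?u = "\<lambda>x. (g x ^ q + g (flip j x) ^ q) / 2" and ?v = "\<lambda>x. ((g x + g (flip j x)) / 2) ^ q"
  have pos: "0 < cexp n (?N t)" if "0 \<le> t" "t \<le> 1 / 2" for t
    by (rule cexp_pos[where x = z]) (use mix_pos[OF that] z in auto)
  have avg: "cexp n (?N t) = cexp n (\<lambda>x. (((1 - t) * g x + t * g (flip j x)) ^ q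
      + ((1 - t) * g (flip j x) + t * g x) ^ q) / 2)" if "0 \<le> t" "t \<le> 1 / 2" for t
    unfolding cexp_flip_average[OF j, of "?N t"]
  proof (rule cexp_cong)
    fix x assume x: "x \<in> cube n"
    have "flip j (flip j x) = x" using x j by (simp add: flip_flip cube_def)
    then show "(?N t x + ?N t (flip j x)) / 2 = (((1 - t) * g x + t * g (flip j x)) ^ q
      + ((1 - t) * g (flip j x) + t * g x) ^ q) / 2"
      using mix_nonneg[OF that, of x] mix_nonneg[OF that, of "flip j x"] x
      by (simp add: mix_def)
  qed
  \<comment> \<open>Rate \<open>0\<close> leaves the pair unchanged, and rate \<open>1 / 2\<close>
    replaces both values by their mean.\<close>
  have u: "cexp n (?N 0) = cexp n ?u" by (subst avg) auto
  have v: "cexp n (?N (1 / 2)) = cexp n ?v"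
    by (subst avg) (auto simp: add_divide_distrib add.commute)
  have "cexp n (?N e) \<le> cexp n (\<lambda>x. ?u x powr ?l * ?v x powr (1 - ?l))"
    unfolding avg[OF e] using g_nonneg by (intro cexp_mono two_point_power_mean[OF e q]) auto
  also have "\<dots> \<le> cexp n ?u powr ?l * cexp n ?v powr (1 - ?l)"
    using pos[of 0] pos[of "1 / 2"] g_nonneg lam_q_bounds[OF e q] unfolding u v
    by (intro cexp_powr_mult_powr_le) auto
  finally have "ln (cexp n (?N e)) \<le> ln (cexp n (?N 0) powr ?l * cexp n (?N (1 / 2)) powr (1 - ?l))"
    using pos[OF e] unfolding u v by simp
  also have "\<dots> = ?l * ln (cexp n (?N 0)) + (1 - ?l) * ln (cexp n (?N (1 / 2)))"
    using pos[of 0] pos[of "1 / 2"] by (simp add: ln_mult ln_powr)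
  finally have "ln (cexp n (?N e)) / real q
      \<le> (?l * ln (cexp n (?N 0)) + (1 - ?l) * ln (cexp n (?N (1 / 2)))) / real q"
    by (rule divide_right_mono) simp
  then show ?thesis
    unfolding qnorm_def using pos[of 0] pos[of "1 / 2"] pos[OF e]
    by (simp add: ln_powr add_divide_distrib)
qed

text \<open>No averaging is required: the two-point bound is applied at a maximiser of the noisy
  function, and both of its factors are dominated by supremum norms.\<close>

lemma ln_supnorm_mix_le:
  assumes e: "0 \<le> e" "e \<le> 1 / 2"
  shows "ln (supnorm n (mix j e g)) \<le> lam_inf e * ln (supnorm n (mix j 0 g))
     + (1 - lam_inf e) * ln (supnorm n (mix j (1 / 2) g))"
proof -
  let ?l = "lam_inf e"
  have pos: "0 < supnorm n (mix j t g)" if "0 \<le> t" "t \<le> 1 / 2" for t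
    using mix_pos[OF that] le_supnorm[OF z(1), of "mix j t g"] by simp
  obtain x where x: "x \<in> cube n" "supnorm n (mix j e g) = \<bar>mix j e g x\<bar>"
    by (rule supnorm_attained)
  have "supnorm n (mix j e g) = (1 - e) * g x + e * g (flip j x)"
    using x mix_nonneg[OF e x(1)] by (simp add: mix_def)
  also have "\<dots> \<le> max (g x) (g (flip j x)) powr ?l * ((g x + g (flip j x)) / 2) powr (1 - ?l)"
    using x g_nonneg by (intro two_point_max e) auto
  also have "\<dots> \<le> supnorm n (mix j 0 g) powr ?l * supnorm n (mix j (1 / 2) g) powr (1 - ?l)"
    using x g_nonneg lam_inf_bounds[OF e] le_supnorm[of x n "mix j (1 / 2) g"]
      le_supnorm[of x n "mix j 0 g"] le_supnorm[of "flip j x" n "mix j 0 g"]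
    by (intro mult_mono powr_mono2) (auto simp: mix_def add_divide_distrib le_max_iff_disj)
  finally have "ln (supnorm n (mix j e g))
      \<le> ln (supnorm n (mix j 0 g) powr ?l * supnorm n (mix j (1 / 2) g) powr (1 - ?l))"
    using pos[OF e] by simp
  then show ?thesis using pos[of 0] pos[of "1 / 2"] by (simp add: ln_mult ln_powr)
qed

end

section \<open>From one coordinate to the expectation over random subsets\<close>

lemma rsubset_exp_cong:
  "(\<And>T. T \<subseteq> {..<n} \<Longrightarrow> h T = k T) \<Longrightarrow> rsubset_exp n l h = rsubset_exp n l k"
  unfolding rsubset_exp_def by (intro sum.cong) auto

text \<open>Conditions on whether the last element \<open>m\<close> belongs to the random
  set.\<close>

lemma rsubset_exp_Suc:
  "rsubset_exp (Suc m) l h = l * rsubset_exp m l (\<lambda>T. h (insert m T)) + (1 - l) * rsubset_exp m l h"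
proof -
  have fin: "finite T" "m \<notin> T" "card T \<le> m" if "T \<in> Pow {..<m}" for T
    using that finite_subset[of T "{..<m}"] card_mono[of "{..<m}" T] by auto
  have inj: "inj_on (insert m) (Pow {..<m})" by (auto simp: inj_on_def)
  let ?t = "\<lambda>T. l ^ card T * (1 - l) ^ (Suc m - card T) * h T"
  have "rsubset_exp (Suc m) l h = sum ?t (Pow {..<m}) + sum ?t (insert m ` Pow {..<m})"
    unfolding rsubset_exp_def lessThan_Suc Pow_insert by (rule sum.union_disjoint) auto
  also have "sum ?t (Pow {..<m}) = (1 - l) * rsubset_exp m l h"
    unfolding rsubset_exp_def sum_distrib_left
    by (rule sum.cong) (simp_all add: Suc_diff_le[OF fin(3)] mult_ac)
  also have "sum ?t (insert m ` Pow {..<m}) = l * rsubset_exp m l (\<lambda>T. h (insert m T))"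
    unfolding rsubset_exp_def sum_distrib_left sum.reindex[OF inj]
    by (rule sum.cong) (use fin in \<open>auto simp: card_insert_if\<close>)
  finally show ?thesis by simp
qed

text \<open>\<open>H\<close> depends on a vector of noise rates. Each rate \<open>e\<close> is
  replaced by \<open>0\<close> with weight \<open>l\<close> or by \<open>1 / 2\<close> with weight
  \<open>1 - l\<close>, and \<open>T\<close> records where \<open>0\<close> was chosen. In the
  induction the rates \<open>p\<close> of the other coordinates stay arbitrary, so that the
  hypothesis applies to both replacements.\<close>

lemma rsubset_exp_ge:
  fixes H :: "(nat \<Rightarrow> real) \<Rightarrow> real"
  assumes l: "0 \<le> l" "l \<le> 1" and e: "0 \<le> e" "e \<le> 1 / 2"
    and step: "\<And>p j. (\<And>i. p i \<in> {0..1/2}) \<Longrightarrow> j < n \<Longrightarrow>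
        H (p(j := e)) \<le> l * H (p(j := 0)) + (1 - l) * H (p(j := 1 / 2))"
  shows "H (\<lambda>i. if i < n then e else 1 / 2) \<le> rsubset_exp n l (\<lambda>T. H (\<lambda>i. if i \<in> T then 0 else 1 / 2))"
proof -
  have "H (\<lambda>i. if i < m then e else p i)
      \<le> rsubset_exp m l (\<lambda>T. H (\<lambda>i. if i \<in> T then 0 else if i < m then 1 / 2 else p i))"
    if "m \<le> n" "\<And>i. p i \<in> {0..1/2}" for m p
    using that
  proof (induction m arbitrary: p)
    case 0
    then show ?case by (simp add: rsubset_exp_def)
  next
    case (Suc m)
    let ?q = "\<lambda>i. if i < m then e else p i"
    let ?R = "\<lambda>p. rsubset_exp m l (\<lambda>T. H (\<lambda>i. if i \<in> T then 0 else if i < m then 1 / 2 else p i))"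
    have upd: "?q(m := t) = (\<lambda>i. if i < m then e else (p(m := t)) i)" for t by auto
    have "(\<lambda>i. if i < Suc m then e else p i) = ?q(m := e)" by (auto simp: less_Suc_eq)
    then have "H (\<lambda>i. if i < Suc m then e else p i) = H (?q(m := e))" by (rule arg_cong)
    also have "\<dots> \<le> l * H (?q(m := 0)) + (1 - l) * H (?q(m := 1 / 2))"
      using Suc.prems e by (intro step) auto
    also have "\<dots> \<le> l * ?R (p(m := 0)) + (1 - l) * ?R (p(m := 1 / 2))"
      unfolding upd using Suc.prems l by (intro add_mono mult_left_mono Suc.IH) auto
    \<comment> \<open>A rate \<open>0\<close> at \<open>m\<close> amounts to adding \<open>m\<close>
      to \<open>T\<close>; in the next step, rate \<open>1 / 2\<close> leaves \<open>m\<close>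
      outside \<open>T\<close>.\<close>
    also have "?R (p(m := 0)) = rsubset_exp m l (\<lambda>T. H (\<lambda>i. if i \<in> insert m T then 0 else if i < Suc m then 1 / 2 else p i))"
      by (intro rsubset_exp_cong arg_cong[where f = H] ext) (auto simp: less_Suc_eq)
    also have "?R (p(m := 1 / 2)) = rsubset_exp m l (\<lambda>T. H (\<lambda>i. if i \<in> T then 0 else if i < Suc m then 1 / 2 else p i))"
      by (intro rsubset_exp_cong arg_cong[where f = H] ext) (auto simp: less_Suc_eq)
    finally show ?case by (simp only: rsubset_exp_Suc)
  qed
  \<comment> \<open>For the constant \<open>1 / 2\<close> all coordinates outside \<open>T\<close>
    carry the same rate.\<close>
  from this[of n "\<lambda>_. 1 / 2"] show ?thesis by (simp cong: if_cong)
qed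

text \<open>Changing one rate affects only one summand, so the one-coordinate relation for
  \<open>h\<close> gives the step for \<open>H\<close> with equality. Then
  \<open>rsubset_exp_ge\<close> applies to both \<open>H\<close> and its negative.\<close>

lemma rsubset_exp_additive:
  fixes h :: "nat \<Rightarrow> real \<Rightarrow> real"
  assumes l: "0 \<le> l" "l \<le> 1" and e: "0 \<le> e" "e \<le> 1 / 2"
    and H: "\<And>p. (\<And>i. p i \<in> {0..1/2}) \<Longrightarrow> H p = (\<Sum>i<n. h i (p i))"
    and h: "\<And>i. i < n \<Longrightarrow> h i e = l * h i 0 + (1 - l) * h i (1 / 2)"
  shows "H (\<lambda>i. if i < n then e else 1 / 2) = rsubset_exp n l (\<lambda>T. H (\<lambda>i. if i \<in> T then 0 else 1 / 2))"
proof -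
  have step: "H (p(j := e)) = l * H (p(j := 0)) + (1 - l) * H (p(j := 1 / 2))"
    if p: "\<And>i. p i \<in> {0..1/2}" and j: "j < n" for p j
  proof -
    have "H (p(j := t)) = h j t + (\<Sum>i\<in>{..<n} - {j}. h i (p i))" if "t \<in> {0..1/2}" for t
    proof -
      have "H (p(j := t)) = (\<Sum>i<n. h i ((p(j := t)) i))" using p that by (intro H) auto
      also have "\<dots> = h j t + (\<Sum>i\<in>{..<n} - {j}. h i ((p(j := t)) i))"
        using j by (subst sum.remove[of _ j]) auto
      finally show ?thesis by (auto intro: sum.cong)
    qed
    then show ?thesis using e h[OF j] by (simp add: algebra_simps)
  qed
  have "H (\<lambda>i. if i < n then e else 1 / 2) \<le> rsubset_exp n l (\<lambda>T. H (\<lambda>i. if i \<in> T then 0 else 1 / 2))"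
    by (rule rsubset_exp_ge[OF l e], rule eq_refl, rule step)
  moreover have "(\<lambda>p. - H p) (\<lambda>i. if i < n then e else 1 / 2)
      \<le> rsubset_exp n l (\<lambda>T. (\<lambda>p. - H p) (\<lambda>i. if i \<in> T then 0 else 1 / 2))"
  proof (rule rsubset_exp_ge[OF l e])
    fix p :: "nat \<Rightarrow> real" and j assume "\<And>i. p i \<in> {0..1/2}" "j < n"
    from step[OF this] show "- H (p(j := e)) \<le> l * - H (p(j := 0)) + (1 - l) * - H (p(j := 1 / 2))"
      by simp
  qed
  then have "- H (\<lambda>i. if i < n then e else 1 / 2) \<le> - rsubset_exp n l (\<lambda>T. H (\<lambda>i. if i \<in> T then 0 else 1 / 2))"
    by (simp add: rsubset_exp_def sum_negf)
  ultimately show ?thesis by simp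
qed

section \<open>Noise with a separate rate in each coordinate\<close>

text \<open>A common family for both operators of the theorem: constant rates give the noise
  operator, and rates in \<open>{0, 1/2}\<close> give conditional expectations.\<close>

definition noise_vec :: "nat \<Rightarrow> (nat \<Rightarrow> real) \<Rightarrow> (bool list \<Rightarrow> real) \<Rightarrow> bool list \<Rightarrow> real" where
  "noise_vec n p f x = (\<Sum>y\<in>cube n. (\<Prod>i<n. if y ! i = x ! i then 1 - p i else p i) * f y)"

lemma noise_eq_noise_vec:
  assumes "x \<in> cube n"
  shows "noise n e f x = noise_vec n (\<lambda>i. if i < n then e else 1 / 2) f x"
  unfolding noise_def noise_vec_def
proof (intro sum.cong refl arg_cong2[where f = "(*)"])
  fix y assume y: "y \<in> cube n"
  let ?D = "{i. i < n \<and> y ! i \<noteq> x ! i}"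
  have "hdist y x = card ?D" using y by (simp add: hdist_def cube_def)
  moreover have "n - card ?D = card ({..<n} - ?D)" by (subst card_Diff_subset) auto
  ultimately have "e ^ hdist y x * (1 - e) ^ (n - hdist y x) = (\<Prod>i\<in>?D. e) * (\<Prod>i\<in>{..<n} - ?D. 1 - e)"
    by simp
  also have "\<dots> = (\<Prod>i\<in>?D. if y ! i = x ! i then 1 - e else e) * (\<Prod>i\<in>{..<n} - ?D. if y ! i = x ! i then 1 - e else e)"
    by (intro arg_cong2[where f = "(*)"] prod.cong) auto
  also have "\<dots> = (\<Prod>i<n. if y ! i = x ! i then 1 - e else e)"
    by (subst mult.commute, rule prod.subset_diff[symmetric]) auto
  also have "\<dots> = (\<Prod>i<n. if y ! i = x ! i then 1 - (if i < n then e else 1 / 2) else (if i < n then e else 1 / 2))"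
    by (intro prod.cong) auto
  finally show "e ^ hdist y x * (1 - e) ^ (n - hdist y x) = \<dots>" .
qed

text \<open>Rate \<open>0\<close> forces agreement on \<open>T\<close>, and every other coordinate
  contributes a factor \<open>1 / 2\<close> whatever its value. The resulting constant weight is the
  reciprocal of \<open>card S\<close>, which \<open>sum_cube_prod\<close> counts as
  \<open>Z\<close>.\<close>

lemma condexp_eq_noise_vec:
  assumes T: "T \<subseteq> {..<n}"
  shows "condexp n T f x = noise_vec n (\<lambda>i. if i \<in> T then 0 else 1 / 2) f x"
proof -
  define S where "S = {y\<in>cube n. \<forall>i\<in>T. y ! i = x ! i}"
  define c where "c i b = (if i \<in> T then of_bool (b = x ! i) else (1::real))" for i b
  define Z where "Z = (\<Prod>i<n. if i \<in> T then 1 else (2::real))"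
  have c: "(\<Prod>i<n. c i (y ! i)) = of_bool (\<forall>i\<in>T. y ! i = x ! i)" for y
  proof (cases "\<forall>i\<in>T. y ! i = x ! i")
    case True
    then show ?thesis by (auto simp: c_def intro!: prod.neutral)
  next
    case False
    then show ?thesis using T by (auto simp: c_def prod_zero_iff)
  qed
  have sum_S: "(\<Sum>y\<in>S. h y) = (\<Sum>y\<in>cube n. (\<Prod>i<n. c i (y ! i)) * h y)" for h
    unfolding c S_def by (simp add: sum.inter_filter of_bool_def if_distrib[of "\<lambda>t. t * _"] cong: if_cong)
  have "real (card S) = (\<Sum>y\<in>S. 1)" by simp
  also have "\<dots> = (\<Prod>i<n. c i True + c i False)" unfolding sum_S by (simp add: sum_cube_prod)
  also have "\<dots> = Z" unfolding Z_def by (intro prod.cong) (auto simp: c_def)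
  finally have card: "real (card S) = Z" .
  have "noise_vec n (\<lambda>i. if i \<in> T then 0 else 1 / 2) f x
      = (\<Sum>y\<in>cube n. (\<Prod>i<n. c i (y ! i) / (if i \<in> T then 1 else 2)) * f y)"
    unfolding noise_vec_def
    by (intro sum.cong prod.cong arg_cong2[where f = "(*)"]) (auto simp: c_def)
  also have "\<dots> = (\<Sum>y\<in>S. f y) / Z"
    unfolding sum_S prod_dividef Z_def by (simp add: sum_divide_distrib)
  finally show ?thesis by (simp add: condexp_def S_def[symmetric] card)
qed

text \<open>The kernel is a product over coordinates. At rate \<open>0\<close> its factor at
  \<open>j\<close> is the indicator of \<open>y ! j = x ! j\<close>, and mixing with the flipped
  point restores the factor for rate \<open>t\<close> without touching the others.\<close>

lemma noise_vec_upd: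
  assumes j: "j < n" and x: "x \<in> cube n"
  shows "noise_vec n (p(j := t)) f x = mix j t (noise_vec n (p(j := 0)) f) x"
proof -
  have len: "j < length x" using assms by (simp add: cube_def)
  have split: "(\<Prod>i<n. if y ! i = z ! i then 1 - (p(j := s)) i else (p(j := s)) i)
      = (if y ! j = z ! j then 1 - s else s) * (\<Prod>i\<in>{..<n} - {j}. if y ! i = z ! i then 1 - p i else p i)"
    for y z s
    using j by (subst prod.remove[of _ j]) (auto intro!: prod.cong cong: if_cong)
  have same: "(\<Prod>i\<in>{..<n} - {j}. if y ! i = flip j x ! i then 1 - p i else p i)
      = (\<Prod>i\<in>{..<n} - {j}. if y ! i = x ! i then 1 - p i else p i)" for y
    by (rule prod.cong) (auto simp: nth_flip[OF len])
  show ?thesis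
    unfolding noise_vec_def mix_def split same sum_distrib_left sum.distrib[symmetric]
    by (rule sum.cong) (auto simp: nth_flip[OF len])
qed

lemma noise_vec_nonneg:
  assumes "\<And>x. x \<in> cube n \<Longrightarrow> 0 \<le> f x" "\<And>i. p i \<in> {0..1/2}"
  shows "0 \<le> noise_vec n p f x"
proof -
  have "0 \<le> p i" "p i \<le> 1" for i using assms(2)[of i] by auto
  then show ?thesis unfolding noise_vec_def
    by (intro sum_nonneg mult_nonneg_nonneg prod_nonneg assms(1)) auto
qed

lemma noise_vec_pos:
  assumes f: "\<And>x. x \<in> cube n \<Longrightarrow> 0 \<le> f x" and p: "\<And>i. p i \<in> {0..1/2}"
    and z: "z \<in> cube n" "0 < f z"
  shows "0 < noise_vec n p f z"
proof -
  have p': "0 \<le> p i" "p i < 1" for i using p[of i] by auto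
  then have "0 < (\<Prod>i<n. if z ! i = z ! i then 1 - p i else p i)" by (intro prod_pos) auto
  then show ?thesis unfolding noise_vec_def using p' z
    by (intro sum_pos2[where i = z] mult_nonneg_nonneg prod_nonneg f mult_pos_pos)
       (auto simp: less_imp_le)
qed

section \<open>Subcubes, where the logarithmic norms are sums over coordinates\<close>

text \<open>The indicator of a subcube is a product over coordinates, so noise acts on each factor
  separately; outside \<open>K\<close> the kernel weights sum to one.\<close>

lemma noise_vec_subcube:
  assumes f: "\<And>x. x \<in> cube n \<Longrightarrow> f x = (if \<forall>i\<in>K. x ! i = a i then 1 else 0)" and K: "K \<subseteq> {..<n}"
  shows "noise_vec n p f x = (\<Prod>i<n. if i \<in> K then if x ! i = a i then 1 - p i else p i else 1)"
proof -
  define d where "d i b = (if i \<in> K then of_bool (b = a i) else (1::real))" for i b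
  have d: "f y = (\<Prod>i<n. d i (y ! i))" if "y \<in> cube n" for y
  proof (cases "\<forall>i\<in>K. y ! i = a i")
    case True
    then have "(\<Prod>i<n. d i (y ! i)) = 1" unfolding d_def by (intro prod.neutral) auto
    then show ?thesis using True f[OF that] by simp
  next
    case False
    then have "(\<Prod>i<n. d i (y ! i)) = 0" using K by (auto simp: d_def prod_zero_iff)
    then show ?thesis using False f[OF that] by auto
  qed
  have "noise_vec n p f x = (\<Sum>y\<in>cube n. \<Prod>i<n. (if y ! i = x ! i then 1 - p i else p i) * d i (y ! i))"
    unfolding noise_vec_def by (intro sum.cong) (simp_all add: d prod.distrib)
  also have "\<dots> = (\<Prod>i<n. (if True = x ! i then 1 - p i else p i) * d i True
      + (if False = x ! i then 1 - p i else p i) * d i False)"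
    by (rule sum_cube_prod)
  also have "\<dots> = (\<Prod>i<n. if i \<in> K then if x ! i = a i then 1 - p i else p i else 1)"
    by (intro prod.cong) (auto simp: d_def)
  finally show ?thesis .
qed

text \<open>The \<open>q\<close>-th moment of a product function is the product of one-coordinate
  moments, and \<open>2 ^ n\<close> supplies one factor \<open>2\<close> to each of them.\<close>

lemma ln_qnorm_noise_vec_subcube:
  assumes f: "\<And>x. x \<in> cube n \<Longrightarrow> f x = (if \<forall>i\<in>K. x ! i = a i then 1 else 0)" and K: "K \<subseteq> {..<n}"
    and p: "\<And>i. p i \<in> {0..1/2}"
  shows "ln (qnorm n q (noise_vec n p f)) = (\<Sum>i<n. if i \<in> K then ln ((p i ^ q + (1 - p i) ^ q) / 2) / real q else 0)"
proof -
  have nv: "noise_vec n p f x = (\<Prod>i<n. if i \<in> K then if x ! i = a i then 1 - p i else p i else 1)" for x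
    by (rule noise_vec_subcube[OF f K])
  have p': "0 \<le> p i" "p i < 1" for i using p[of i] by auto
  define w where "w i = (if i \<in> K then (p i ^ q + (1 - p i) ^ q) / 2 else 1)" for i
  have w: "0 < w i" for i
    unfolding w_def using p'[of i] by (auto intro!: add_nonneg_pos divide_pos_pos)
  let ?c = "\<lambda>i b. (if i \<in> K then if b = a i then 1 - p i else p i else 1) ^ q"
  have "cexp n (\<lambda>x. \<bar>noise_vec n p f x\<bar> ^ q) = (\<Sum>x\<in>cube n. \<Prod>i<n. ?c i (x ! i)) / 2 ^ n"
    unfolding cexp_def nv using p'
    by (intro arg_cong2[where f = "(/)"] sum.cong refl)
       (auto simp: prod_power_distrib[symmetric] abs_prod less_imp_le intro!: prod.cong arg_cong[where f = "\<lambda>t. t ^ q"])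
  also have "\<dots> = (\<Prod>i<n. ?c i True + ?c i False) / (\<Prod>i<n. 2)"
    by (subst sum_cube_prod) simp
  also have "\<dots> = prod w {..<n}"
    unfolding prod_dividef[symmetric] w_def by (intro prod.cong) auto
  finally have "ln (qnorm n q (noise_vec n p f)) = ln (prod w {..<n}) / real q"
    unfolding qnorm_def using w by (simp add: ln_powr)
  also have "ln (prod w {..<n}) = (\<Sum>i<n. ln (w i))" using w by (intro ln_prod) (auto simp: less_imp_neq[symmetric])
  finally show ?thesis unfolding sum_divide_distrib by (auto simp: w_def intro!: sum.cong)
qed

lemma ln_supnorm_noise_vec_subcube:
  assumes f: "\<And>x. x \<in> cube n \<Longrightarrow> f x = (if \<forall>i\<in>K. x ! i = a i then 1 else 0)" and K: "K \<subseteq> {..<n}"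
    and p: "\<And>i. p i \<in> {0..1/2}"
  shows "ln (supnorm n (noise_vec n p f)) = (\<Sum>i<n. if i \<in> K then ln (1 - p i) else 0)"
proof -
  have nv: "noise_vec n p f x = (\<Prod>i<n. if i \<in> K then if x ! i = a i then 1 - p i else p i else 1)" for x
    by (rule noise_vec_subcube[OF f K])
  have p': "0 \<le> p i" "p i \<le> 1 - p i" "p i < 1" for i using p[of i] by auto
  define w where "w i = (if i \<in> K then 1 - p i else 1)" for i
  have w: "0 < w i" for i using p'[of i] by (simp add: w_def)
  have "supnorm n (noise_vec n p f) = prod w {..<n}"
    unfolding supnorm_def
  proof (rule Max_eqI)
    \<comment> \<open>A point of the subcube maximises, since \<open>p i \<le> 1 - p i\<close> in
      each factor.\<close>
    let ?x = "map a [0..<n]"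
    have "noise_vec n p f ?x = prod w {..<n}"
      unfolding nv w_def by (intro prod.cong) auto
    moreover have "0 < prod w {..<n}" using w by (intro prod_pos) auto
    ultimately have "prod w {..<n} = \<bar>noise_vec n p f ?x\<bar>" by simp
    moreover have "?x \<in> cube n" by (simp add: cube_def)
    ultimately show "prod w {..<n} \<in> (\<lambda>x. \<bar>noise_vec n p f x\<bar>) ` cube n" by (rule image_eqI)
    fix y assume "y \<in> (\<lambda>x. \<bar>noise_vec n p f x\<bar>) ` cube n"
    then obtain x where "y = \<bar>noise_vec n p f x\<bar>" by auto
    also have "\<dots> = (\<Prod>i<n. \<bar>if i \<in> K then if x ! i = a i then 1 - p i else p i else 1\<bar>)"
      unfolding nv abs_prod ..
    also have "\<dots> \<le> prod w {..<n}"
      using p' by (intro prod_mono) (auto simp: w_def less_imp_le)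
    finally show "y \<le> prod w {..<n}" .
  qed simp
  also have "ln (prod w {..<n}) = (\<Sum>i<n. ln (w i))" using w by (intro ln_prod) (auto simp: less_imp_neq[symmetric])
  finally show ?thesis by (auto simp: w_def intro!: sum.cong)
qed

theorem theorem1p1:
  fixes n :: nat and \<epsilon> :: real and f :: "bool list \<Rightarrow> real"
  assumes "n \<ge> 1" and "0 \<le> \<epsilon>" and "\<epsilon> \<le> 1 / 2"
    and "\<forall>x\<in>cube n. f x \<ge> 0" and "\<exists>x\<in>cube n. f x \<noteq> 0"
  shows "(\<forall>q::nat. q \<ge> 2 \<longrightarrow>
            ln (qnorm n q (noise n \<epsilon> f))
              \<le> rsubset_exp n (lam_q q \<epsilon>) (\<lambda>T. ln (qnorm n q (condexp n T f))))
       \<and> ln (supnorm n (noise n \<epsilon> f))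
              \<le> rsubset_exp n (lam_inf \<epsilon>) (\<lambda>T. ln (supnorm n (condexp n T f)))
       \<and> (\<forall>K a. K \<subseteq> {..<n} \<longrightarrow>
            (\<forall>x\<in>cube n. f x = (if (\<forall>i\<in>K. x ! i = a i) then 1 else 0)) \<longrightarrow>
            (\<forall>q::nat. q \<ge> 2 \<longrightarrow>
               ln (qnorm n q (noise n \<epsilon> f))
                 = rsubset_exp n (lam_q q \<epsilon>) (\<lambda>T. ln (qnorm n q (condexp n T f))))
            \<and> ln (supnorm n (noise n \<epsilon> f))
                 = rsubset_exp n (lam_inf \<epsilon>) (\<lambda>T. ln (supnorm n (condexp n T f))))"
proof -
  note e = assms(2,3)
  let ?N = "\<lambda>p. noise_vec n p f"
  let ?pe = "\<lambda>i. if i < n then \<epsilon> else 1 / 2" and ?pT = "\<lambda>T i. if i \<in> T then 0 else 1 / 2"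
  obtain z where z: "z \<in> cube n" "0 < f z" using assms(4,5) by force
  have f: "0 \<le> f x" if "x \<in> cube n" for x using assms(4) that by blast
  have qnorm_eq: "qnorm n q (noise n \<epsilon> f) = qnorm n q (?N ?pe)"
    "rsubset_exp n l (\<lambda>T. ln (qnorm n q (condexp n T f))) = rsubset_exp n l (\<lambda>T. ln (qnorm n q (?N (?pT T))))" for q l
    by (intro qnorm_cong noise_eq_noise_vec rsubset_exp_cong arg_cong[where f = ln] condexp_eq_noise_vec; assumption)+
  have supnorm_eq: "supnorm n (noise n \<epsilon> f) = supnorm n (?N ?pe)"
    "rsubset_exp n l (\<lambda>T. ln (supnorm n (condexp n T f))) = rsubset_exp n l (\<lambda>T. ln (supnorm n (?N (?pT T))))" for l
    by (intro supnorm_cong noise_eq_noise_vec rsubset_exp_cong arg_cong[where f = ln] condexp_eq_noise_vec; assumption)+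
  have upd: "qnorm n q (?N (p(j := t))) = qnorm n q (mix j t (?N (p(j := 0))))"
    "supnorm n (?N (p(j := t))) = supnorm n (mix j t (?N (p(j := 0))))" if "j < n" for p j t q
    by (intro qnorm_cong supnorm_cong noise_vec_upd that; assumption)+
  have N0: "0 \<le> ?N (p(j := 0)) x" "0 < ?N (p(j := 0)) z" if "\<And>i. p i \<in> {0..1/2}" for p :: "nat \<Rightarrow> real" and j x
    using that z f by (auto intro!: noise_vec_nonneg noise_vec_pos)
  have 1: "ln (qnorm n q (noise n \<epsilon> f)) \<le> rsubset_exp n (lam_q q \<epsilon>) (\<lambda>T. ln (qnorm n q (condexp n T f)))"
    if q: "2 \<le> q" for q
    unfolding qnorm_eq
  proof (rule rsubset_exp_ge[where H = "\<lambda>p. ln (qnorm n q (?N p))", OF lam_q_bounds[OF e q] e])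
    fix p :: "nat \<Rightarrow> real" and j assume p: "\<And>i. p i \<in> {0..1/2}" and j: "j < n"
    show "ln (qnorm n q (?N (p(j := \<epsilon>)))) \<le> lam_q q \<epsilon> * ln (qnorm n q (?N (p(j := 0))))
        + (1 - lam_q q \<epsilon>) * ln (qnorm n q (?N (p(j := 1 / 2))))"
      \<comment> \<open>All three norms, including the one at rate \<open>0\<close>, are written as
        mixtures of the same function \<open>?N (p(j := 0))\<close>.\<close>
      unfolding upd(1)[OF j, of q p \<epsilon>] upd(1)[OF j, of q p "1 / 2"]
      by (subst upd(1)[OF j, of q p 0]) (intro ln_qnorm_mix_le[where z = z] j z e q N0 p)
  qed
  have 2: "ln (supnorm n (noise n \<epsilon> f)) \<le> rsubset_exp n (lam_inf \<epsilon>) (\<lambda>T. ln (supnorm n (condexp n T f)))"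
    unfolding supnorm_eq
  proof (rule rsubset_exp_ge[where H = "\<lambda>p. ln (supnorm n (?N p))", OF lam_inf_bounds[OF e] e])
    fix p :: "nat \<Rightarrow> real" and j assume p: "\<And>i. p i \<in> {0..1/2}" and j: "j < n"
    show "ln (supnorm n (?N (p(j := \<epsilon>)))) \<le> lam_inf \<epsilon> * ln (supnorm n (?N (p(j := 0))))
        + (1 - lam_inf \<epsilon>) * ln (supnorm n (?N (p(j := 1 / 2))))"
      unfolding upd(2)[OF j, of p \<epsilon>] upd(2)[OF j, of p "1 / 2"]
      by (subst upd(2)[OF j, of p 0]) (intro ln_supnorm_mix_le[where z = z] j z e N0 p)
  qed
  have 3: "ln (qnorm n q (noise n \<epsilon> f)) = rsubset_exp n (lam_q q \<epsilon>) (\<lambda>T. ln (qnorm n q (condexp n T f)))"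
    if K: "K \<subseteq> {..<n}" and fK: "\<forall>x\<in>cube n. f x = (if (\<forall>i\<in>K. x ! i = a i) then 1 else 0)" and q: "2 \<le> q"
    for K a q
    unfolding qnorm_eq
  proof (rule rsubset_exp_additive[where H = "\<lambda>p. ln (qnorm n q (?N p))", OF lam_q_bounds[OF e q] e])
    show "ln (qnorm n q (?N p)) = (\<Sum>i<n. (\<lambda>i t. if i \<in> K then ln ((t ^ q + (1 - t) ^ q) / 2) / real q else 0) i (p i))"
      if "\<And>i. p i \<in> {0..1/2}" for p
      using ln_qnorm_noise_vec_subcube[of n f K a p q] fK K that by simp
    have "0 < \<epsilon> ^ q + (1 - \<epsilon>) ^ q" using e by (intro add_nonneg_pos) auto
    \<comment> \<open>The one-coordinate moment is \<open>1 / 2\<close> at rate \<open>0\<close> and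
      \<open>2\<close> to the power \<open>-q\<close> at rate \<open>1 / 2\<close>. Solving the
      definition of lambda for the logarithm at rate \<open>\<epsilon>\<close> places it on the line
      through these two values.\<close>
    then have "ln ((\<epsilon> ^ q + (1 - \<epsilon>) ^ q) / 2) = (lam_q q \<epsilon> - 1) * (real q - 1) * ln 2 - ln 2"
      using q by (simp add: ln_div lam_q_def log_def)
    moreover have "ln (((1 / 2) ^ q + (1 / 2) ^ q) / 2) = - real q * ln (2::real)"
      by (simp add: ln_realpow power_one_over ln_div)
    moreover have "ln ((0 ^ q + (1 - 0) ^ q) / 2) = - ln (2::real)"
      using q by (simp add: ln_div power_0_left)
    ultimately have "ln ((\<epsilon> ^ q + (1 - \<epsilon>) ^ q) / 2) = lam_q q \<epsilon> * ln ((0 ^ q + (1 - 0) ^ q) / 2)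
        + (1 - lam_q q \<epsilon>) * ln (((1 / 2) ^ q + (1 - 1 / 2) ^ q) / 2)"
      by (simp add: algebra_simps)
    then show "(if i \<in> K then ln ((\<epsilon> ^ q + (1 - \<epsilon>) ^ q) / 2) / real q else 0)
       = lam_q q \<epsilon> * (if i \<in> K then ln ((0 ^ q + (1 - 0) ^ q) / 2) / real q else 0)
       + (1 - lam_q q \<epsilon>) * (if i \<in> K then ln (((1 / 2) ^ q + (1 - 1 / 2) ^ q) / 2) / real q else 0)" for i
      by (simp add: add_divide_distrib)
  qed
  have 4: "ln (supnorm n (noise n \<epsilon> f)) = rsubset_exp n (lam_inf \<epsilon>) (\<lambda>T. ln (supnorm n (condexp n T f)))"
    if K: "K \<subseteq> {..<n}" and fK: "\<forall>x\<in>cube n. f x = (if (\<forall>i\<in>K. x ! i = a i) then 1 else 0)"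
    for K a
    unfolding supnorm_eq
  proof (rule rsubset_exp_additive[where H = "\<lambda>p. ln (supnorm n (?N p))", OF lam_inf_bounds[OF e] e])
    show "ln (supnorm n (?N p)) = (\<Sum>i<n. (\<lambda>i t. if i \<in> K then ln (1 - t) else 0) i (p i))"
      if "\<And>i. p i \<in> {0..1/2}" for p
      using ln_supnorm_noise_vec_subcube[of n f K a p] fK K that by simp
    \<comment> \<open>Inside \<open>K\<close> the relation reads
      \<open>ln (1 - \<epsilon>) = - (1 - lam_inf \<epsilon>) * ln 2\<close>, since the rate
      \<open>0\<close> term vanishes.\<close>
    show "(if i \<in> K then ln (1 - \<epsilon>) else 0) = lam_inf \<epsilon> * (if i \<in> K then ln (1 - 0) else 0)
       + (1 - lam_inf \<epsilon>) * (if i \<in> K then ln (1 - 1 / 2) else 0)" for i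
      by (simp add: lam_inf_def log_def ln_div)
  qed
  show ?thesis using 1 2 3 4 by blast
qed

end
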